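(* Given a node $\sigma$ of the PI-B\&B tree and a subset $\Omega\subseteq\overline{J}_{\sigma}$, $$L_3(\sigma,\Omega)=\min\{w(\mathcal{T}) : \mathcal{T}\text{ is a spanning tree of } G_{\sigma,\Omega}\}$$ provides a valid lower bound on the optimal value of the subproblem associated with node $\sigma$; that is, $L_3(\sigma,\Omega)\le z(\overline{\sigma})$ for every completion $\overline{\sigma}$ of $\sigma$.
   Context: Job Sequencing and Tool Switching Problem (SSP). We are given tools $T=\{1,\dots,m\}$, jobs $J=\{1,\dots,n\}$, a magazine capacity $c<m$, and for each job $j\in J$ a required toolset $T_j\subseteq T$ with $|T_j|\le c$. Every tool is required by some job: $T=\bigcup_{j\in J}T_j$. A (partial) sequence $\sigma=(\sigma_1,\dots,\sigma_l)$ consists of pairwise distinct jobs. Let $J_\sigma=\{\sigma_1,\dots,\sigma_l\}$ and $\overline{J}_\sigma=J\setminus J_\sigma$. A magazine configuration is a set $M\subseteq T$ with $|M|=c$. A sequence of magazine configurations $\mathcal{M}=(M_1,\dots,M_l)$ covers $\sigma$ if $T_{\sigma_i}\subseteq M_i$ for $i=1,\dots,l$. Its number of tool switches is $z(\mathcal{M})=\sum_{i=2}^{l}|M_i\setminus M_{i-1}|$ (so the initial loading is free). Let $z(\sigma)$ be the minimum of $z(\mathcal{M})$ over all $\mathcal{M}$ covering $\sigma$. The SSP asks for a permutation of $J$ minimizing $z$. PI-B\&B tree. Nodes are partial sequences of jobs. The root (level $0$) is a sequence $(\sigma_1,\sigma_2)$ of two distinct jobs chosen to maximize $|T_{\sigma_1}\setminus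 T_{\sigma_2}|+|T_{\sigma_2}\setminus T_{\sigma_1}|$. At a node $\sigma=(\sigma_1,\dots,\sigma_l)$ with $\overline{J}_\sigma\neq\emptyset$, one job $j\in\overline{J}_\sigma$ maximizing $\min_{i\in\{1,\dots,l\}}|T_{\sigma_i}\cup T_j|$ is selected (ties broken in some fixed way), and the $l+1$ children of $\sigma$ are the sequences obtained by inserting $j$ into $\sigma$ at each of the $l+1$ possible positions. Leaves are complete sequences of $n$ jobs. A completion of a node $\sigma$ is any leaf of the subtree rooted at $\sigma$, i.e. any permutation of $J$ obtainable from $\sigma$ by such insertions; equivalently, any permutation of $J$ in which the jobs of $J_\sigma$ appear in the same relative order as in $\sigma$. The optimal value of the subproblem at node $\sigma$ is the minimum of $z(\overline{\sigma})$ over all completions $\overline{\sigma}$ of $\sigma$. Graph $G_{\sigma,\Omega}$. For distinct jobs $j,j'\in J$ let $w_{j,j'}=\max\{0,|T_j\cup T_{j'}|-c\}$. For $\Omega\subseteq\overline{J}_\sigma$, $G_{\sigma,\Omega}=(V,E)$ is the undirected graph with vertex set $V=J_\sigma\cup\Omega$, whose edge set $E$ is obtained from the complete graph on $V$ by removing each edge $\{j,j'\}$ such that $j,j'\in J_\sigma$ and $j,j'$ are not consecutive in $\sigma$; edge $\{j,j'\}$ has weight $w_{j,j'}$. For a spanning tree $\mathcal{T}$ of $G_{\sigma,\Omega}$ with edge set $E(\mathcal{T})$, let $w(\mathcal{T})=\sum_{\{j,j'\}\in E(\mathcal{T})}w_{j,j'}$. *)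

theory Defs
  imports "HOL-Library.Sublist"
begin

(* Undirected simple graphs: a vertex set V and a set E of two-element subsets of V.
   The notion of tree in Graph_Theory.Digraph_Component is not used: it excludes only directed
   cycles, so every connected acyclic orientation of a graph would count as a tree there. *)

definition graph_connected :: "'a set \<Rightarrow> 'a set set \<Rightarrow> bool" where
  "graph_connected V E \<longleftrightarrow> V \<noteq> {} \<and> (\<forall>u\<in>V. \<forall>v\<in>V. (u, v) \<in> {(x, y). {x, y} \<in> E}\<^sup>*)"

(* The list p enumerates the vertices of the cycle, without repeating the first one at the end. *)
definition graph_cycle :: "'a set set \<Rightarrow> 'a list \<Rightarrow> bool" where
  "graph_cycle E p \<longleftrightarrow> 3 \<le> length p \<and> distinct p \<and>
     (\<forall>i. Suc i < length p \<longrightarrow> {p ! i, p ! Suc i} \<in> E) \<and> {last p, hd p} \<in> E"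

(* A spanning tree of (V, E) has vertex set V and is represented by its edge set F. *)
definition spanning_tree :: "'a set \<Rightarrow> 'a set set \<Rightarrow> 'a set set \<Rightarrow> bool" where
  "spanning_tree V E F \<longleftrightarrow> F \<subseteq> E \<and> graph_connected V F \<and> (\<nexists>p. graph_cycle F p)"


locale ssp =
  fixes m n c :: nat and req :: "nat \<Rightarrow> nat set"
  assumes capacity: "c < m"
    and req_subset: "j \<in> {1..n} \<Longrightarrow> req j \<subseteq> {1..m}"
    and req_card: "j \<in> {1..n} \<Longrightarrow> card (req j) \<le> c"
    and req_covers: "{1..m} = (\<Union>j\<in>{1..n}. req j)"
begin

definition partial_seq :: "nat list \<Rightarrow> bool" where
  "partial_seq \<sigma> \<longleftrightarrow> distinct \<sigma> \<and> set \<sigma> \<subseteq> {1..n}"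

definition rest :: "nat list \<Rightarrow> nat set" where
  "rest \<sigma> = {1..n} - set \<sigma>"

definition configuration :: "nat set \<Rightarrow> bool" where
  "configuration M \<longleftrightarrow> M \<subseteq> {1..m} \<and> card M = c"

definition covers :: "nat set list \<Rightarrow> nat list \<Rightarrow> bool" where
  "covers Ms \<sigma> \<longleftrightarrow> length Ms = length \<sigma> \<and> (\<forall>M\<in>set Ms. configuration M) \<and>
     (\<forall>i<length \<sigma>. req (\<sigma> ! i) \<subseteq> Ms ! i)"

definition switches :: "nat set list \<Rightarrow> nat" where
  "switches Ms = (\<Sum>i = 1..<length Ms. card (Ms ! i - Ms ! (i - 1)))"

definition z :: "nat list \<Rightarrow> nat" where
  "z \<sigma> = Min {switches Ms | Ms. covers Ms \<sigma>}"

(* For e = {j, j'} the truncated subtraction on nat gives max 0 (card (req j \<union> req j') - c). *)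
definition weight :: "nat set \<Rightarrow> nat" where
  "weight e = card (\<Union>j\<in>e. req j) - c"

definition consecutive :: "nat list \<Rightarrow> nat \<Rightarrow> nat \<Rightarrow> bool" where
  "consecutive \<sigma> j j' \<longleftrightarrow> (\<exists>i. Suc i < length \<sigma> \<and> {j, j'} = {\<sigma> ! i, \<sigma> ! Suc i})"

definition G_verts :: "nat list \<Rightarrow> nat set \<Rightarrow> nat set" where
  "G_verts \<sigma> \<Omega> = set \<sigma> \<union> \<Omega>"

definition G_edges :: "nat list \<Rightarrow> nat set \<Rightarrow> nat set set" where
  "G_edges \<sigma> \<Omega> =
     {{j, j'} | j j'. j \<in> G_verts \<sigma> \<Omega> \<and> j' \<in> G_verts \<sigma> \<Omega> \<and> j \<noteq> j'} -
     {{j, j'} | j j'. j \<in> set \<sigma> \<and> j' \<in> set \<sigma> \<and> \<not> consecutive \<sigma> j j'}"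

definition L3 :: "nat list \<Rightarrow> nat set \<Rightarrow> nat" where
  "L3 \<sigma> \<Omega> = Min {\<Sum>e\<in>F. weight e | F. spanning_tree (G_verts \<sigma> \<Omega>) (G_edges \<sigma> \<Omega>) F}"

lemma finite_switches: "finite {switches Ms | Ms. covers Ms \<sigma>}"
proof -
  have "{Ms. covers Ms \<sigma>} \<subseteq> {Ms. set Ms \<subseteq> Pow {1..m} \<and> length Ms = length \<sigma>}"
    by (auto simp: covers_def configuration_def)
  then have "finite {Ms. covers Ms \<sigma>}"
    by (rule finite_subset) (simp add: finite_lists_length_eq)
  then show ?thesis by simp
qed

lemma ex_covers:
  assumes "partial_seq \<sigma>"
  shows "\<exists>Ms. covers Ms \<sigma>"
proof -
  have "\<exists>M. req j \<subseteq> M \<and> configuration M" if "j \<in> {1..n}" for j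
    using exists_subset_between[of "req j" c "{1..m}"] req_subset[OF that] req_card[OF that] capacity
    by (auto simp: configuration_def)
  then obtain f where f: "req j \<subseteq> f j" "configuration (f j)" if "j \<in> {1..n}" for j
    by metis
  have "covers (map f \<sigma>) \<sigma>"
    unfolding covers_def
  proof (intro conjI allI impI ballI)
    fix M
    assume "M \<in> set (map f \<sigma>)"
    then show "configuration M" using assms f(2) unfolding partial_seq_def by auto
  next
    fix i
    assume i: "i < length \<sigma>"
    then have "\<sigma> ! i \<in> {1..n}" using assms nth_mem unfolding partial_seq_def by blast
    then show "req (\<sigma> ! i) \<subseteq> map f \<sigma> ! i" using i f(1) by simp
  qed simp
  then show ?thesis ..
qed

end


(* Ties are broken by an arbitrary function sel of the current sequence. *)
locale pibb = ssp +
  fixes root :: "nat \<times> nat" and sel :: "nat list \<Rightarrow> nat"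
  assumes root: "is_arg_max (\<lambda>(a, b). card (req a - req b) + card (req b - req a))
        (\<lambda>(a, b). a \<in> {1..n} \<and> b \<in> {1..n} \<and> a \<noteq> b) root"
    and sel: "partial_seq \<sigma> \<Longrightarrow> \<sigma> \<noteq> [] \<Longrightarrow> rest \<sigma> \<noteq> {} \<Longrightarrow>
        is_arg_max (\<lambda>j. Min ((\<lambda>i. card (req i \<union> req j)) ` set \<sigma>)) (\<lambda>j. j \<in> rest \<sigma>) (sel \<sigma>)"
begin

definition child :: "nat list \<Rightarrow> nat list \<Rightarrow> bool" where
  "child \<sigma> \<tau> \<longleftrightarrow> rest \<sigma> \<noteq> {} \<and> (\<exists>k\<le>length \<sigma>. \<tau> = take k \<sigma> @ sel \<sigma> # drop k \<sigma>)"

definition node :: "nat list \<Rightarrow> bool" where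
  "node \<sigma> \<longleftrightarrow> child\<^sup>*\<^sup>* [fst root, snd root] \<sigma>"

definition completion :: "nat list \<Rightarrow> nat list \<Rightarrow> bool" where
  "completion \<sigma> \<tau> \<longleftrightarrow> child\<^sup>*\<^sup>* \<sigma> \<tau> \<and> length \<tau> = n"

definition opt :: "nat list \<Rightarrow> nat" where
  "opt \<sigma> = Min {z \<tau> | \<tau>. completion \<sigma> \<tau>}"

lemma sel_in_rest:
  assumes "partial_seq \<sigma>" "\<sigma> \<noteq> []" "rest \<sigma> \<noteq> {}"
  shows "sel \<sigma> \<in> rest \<sigma>"
  using sel[OF assms] by (simp add: is_arg_max_def)

lemma child_partial_seq:
  assumes "child \<sigma> \<tau>" "partial_seq \<sigma>" "\<sigma> \<noteq> []"
  shows "partial_seq \<tau>" "\<tau> \<noteq> []" "subseq \<sigma> \<tau>"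
proof -
  obtain k where k: "\<tau> = take k \<sigma> @ sel \<sigma> # drop k \<sigma>" and "rest \<sigma> \<noteq> {}"
    using assms(1) by (auto simp: child_def)
  then have s: "sel \<sigma> \<in> {1..n}" "sel \<sigma> \<notin> set \<sigma>"
    using sel_in_rest assms by (auto simp: rest_def)
  have "distinct (take k \<sigma> @ drop k \<sigma>)"
    using assms(2) by (simp add: partial_seq_def)
  moreover have "set (take k \<sigma>) \<union> set (drop k \<sigma>) = set \<sigma>"
    by (metis append_take_drop_id set_append)
  ultimately have "distinct \<tau>" "set \<tau> = insert (sel \<sigma>) (set \<sigma>)"
    using s(2) unfolding k distinct_append by auto
  with s assms show "partial_seq \<tau>" by (auto simp: partial_seq_def)
  show "\<tau> \<noteq> []" by (simp add: k)
  have "subseq (take k \<sigma> @ drop k \<sigma>) \<tau>"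
    unfolding k by (intro list_emb_append_mono) auto
  then show "subseq \<sigma> \<tau>" by simp
qed

lemma descendant_partial_seq:
  assumes "child\<^sup>*\<^sup>* \<sigma> \<tau>" "partial_seq \<sigma>" "\<sigma> \<noteq> []"
  shows "partial_seq \<tau> \<and> \<tau> \<noteq> [] \<and> subseq \<sigma> \<tau>"
  using assms
proof (induction rule: rtranclp_induct)
  case (step \<tau> \<tau>')
  then show ?case using child_partial_seq[of \<tau> \<tau>'] subseq_order.trans by blast
qed simp

lemma node_partial_seq:
  assumes "node \<sigma>"
  shows "partial_seq \<sigma> \<and> \<sigma> \<noteq> []"
proof -
  have "partial_seq [fst root, snd root]"
    using root by (auto simp: is_arg_max_def partial_seq_def split: prod.splits)
  then show ?thesis using assms descendant_partial_seq by (auto simp: node_def)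
qed

lemma full_seq:
  assumes "partial_seq \<tau>"
  shows "length \<tau> = n \<longleftrightarrow> set \<tau> = {1..n}"
proof -
  have "card (set \<tau>) = length \<tau>" "set \<tau> \<subseteq> {1..n}"
    using assms by (auto simp: partial_seq_def distinct_card)
  then show ?thesis using card_subset_eq[of "{1..n}" "set \<tau>"] by auto
qed

lemma filter_insert_position:
  assumes "distinct \<tau>" "s \<in> set \<tau>" "s \<notin> A"
  shows "\<exists>k\<le>length (filter (\<lambda>x. x \<in> A) \<tau>). filter (\<lambda>x. x \<in> insert s A) \<tau> =
    take k (filter (\<lambda>x. x \<in> A) \<tau>) @ s # drop k (filter (\<lambda>x. x \<in> A) \<tau>)"
proof -
  obtain xs ys where \<tau>: "\<tau> = xs @ s # ys" using assms(2) by (meson split_list)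
  have "filter (\<lambda>x. x \<in> insert s A) xs = filter (\<lambda>x. x \<in> A) xs"
    "filter (\<lambda>x. x \<in> insert s A) ys = filter (\<lambda>x. x \<in> A) ys"
    using assms by (auto simp: \<tau> intro!: filter_cong)
  then show ?thesis
    using assms(3) by (intro exI[of _ "length (filter (\<lambda>x. x \<in> A) xs)"]) (simp add: \<tau>)
qed

lemma subseq_distinct_filter:
  assumes "subseq xs ys" "distinct ys"
  shows "filter (\<lambda>x. x \<in> set xs) ys = xs"
  using assms
proof (induction rule: list_emb.induct)
  case (list_emb_Cons xs ys y)
  then have "y \<notin> set xs" by (auto dest: list_emb_set)
  with list_emb_Cons show ?case by simp
next
  case (list_emb_Cons2 x y xs ys)
  then have "filter (\<lambda>z. z \<in> insert x (set xs)) ys = filter (\<lambda>z. z \<in> set xs) ys"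
    by (intro filter_cong) auto
  with list_emb_Cons2 show ?case by simp
qed simp

(* The completions are the permutations of all jobs that keep the relative order of \<sigma>. *)
lemma completion_iff:
  assumes "node \<sigma>"
  shows "completion \<sigma> \<tau> \<longleftrightarrow> distinct \<tau> \<and> set \<tau> = {1..n} \<and> subseq \<sigma> \<tau>"
proof
  assume "completion \<sigma> \<tau>"
  then show "distinct \<tau> \<and> set \<tau> = {1..n} \<and> subseq \<sigma> \<tau>"
    using node_partial_seq[OF assms] descendant_partial_seq[of \<sigma> \<tau>] full_seq[of \<tau>]
    unfolding completion_def partial_seq_def by blast
next
  assume \<tau>: "distinct \<tau> \<and> set \<tau> = {1..n} \<and> subseq \<sigma> \<tau>"
  have "child\<^sup>*\<^sup>* \<sigma>' \<tau>"
    if "partial_seq \<sigma>'" "\<sigma>' \<noteq> []" "filter (\<lambda>x. x \<in> set \<sigma>') \<tau> = \<sigma>'" for \<sigma>'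
    using that
  proof (induction "card (rest \<sigma>')" arbitrary: \<sigma>' rule: less_induct)
    case less
    show ?case
    proof (cases "rest \<sigma>' = {}")
      case True
      then have "filter (\<lambda>x. x \<in> set \<sigma>') \<tau> = \<tau>" using \<tau> by (auto simp: rest_def filter_id_conv)
      with less.prems show ?thesis by simp
    next
      case False
      let ?s = "sel \<sigma>'"
      let ?\<rho> = "filter (\<lambda>x. x \<in> insert ?s (set \<sigma>')) \<tau>"
      have s: "?s \<in> rest \<sigma>'" using sel_in_rest less.prems False by blast
      then obtain k where "k \<le> length \<sigma>'" "?\<rho> = take k \<sigma>' @ ?s # drop k \<sigma>'"
        using filter_insert_position[of \<tau> ?s "set \<sigma>'"] \<tau> less.prems(3) by (auto simp: rest_def)
      then have ch: "child \<sigma>' ?\<rho>" using False by (auto simp: child_def)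
      have set\<rho>: "set ?\<rho> = insert ?s (set \<sigma>')"
        using \<tau> s less.prems(1) by (auto simp: rest_def partial_seq_def)
      have "rest ?\<rho> = rest \<sigma>' - {?s}" unfolding rest_def set\<rho> by blast
      with s have "rest ?\<rho> \<subset> rest \<sigma>'" by blast
      then have "card (rest ?\<rho>) < card (rest \<sigma>')"
        by (intro psubset_card_mono) (simp_all add: rest_def)
      then have "child\<^sup>*\<^sup>* ?\<rho> \<tau>"
        using child_partial_seq(1,2)[OF ch less.prems(1,2)] by (rule less.hyps) (simp only: set\<rho>)
      with ch show ?thesis by (rule converse_rtranclp_into_rtranclp)
    qed
  qed
  moreover have "filter (\<lambda>x. x \<in> set \<sigma>) \<tau> = \<sigma>"
    using \<tau> subseq_distinct_filter by blast
  ultimately have "child\<^sup>*\<^sup>* \<sigma> \<tau>" using node_partial_seq[OF assms] by blast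
  moreover have "length \<tau> = n" using \<tau> full_seq unfolding partial_seq_def by blast
  ultimately show "completion \<sigma> \<tau>" unfolding completion_def ..
qed

end

end

theory Submission
  imports Defs
begin

text \<open>
  Delete from a completion \<open>\<tau>\<close> of \<open>\<sigma>\<close> every job outside \<open>V = J\<^sub>\<sigma> \<union> \<Omega>\<close>. The remaining sequence \<open>\<rho>\<close>
  is a Hamiltonian path of \<open>G\<^bsub>\<sigma>,\<Omega>\<^esub>\<close>: since \<open>\<sigma>\<close> is a subsequence of \<open>\<rho>\<close>, two jobs of \<open>\<sigma>\<close> that are
  neighbours in \<open>\<rho>\<close> are neighbours in \<open>\<sigma>\<close> as well, so no edge of the path was removed from the
  complete graph on \<open>V\<close> (\<open>path_edges_subset_G\<close>). A Hamiltonian path is a spanning tree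
  (\<open>spanning_tree_path_edges\<close>), hence \<open>L\<^sub>3(\<sigma>,\<Omega>)\<close> is at most the weight of this path.

  The weight of the path is at most \<open>z(\<rho>)\<close>: two magazines of size \<open>c\<close> that serve \<open>j\<close> and \<open>j'\<close> have
  a union of size at least \<open>|T\<^sub>j \<union> T\<^sub>j\<^sub>'|\<close>, so changing one into the other takes at least \<open>w\<^sub>j\<^sub>,\<^sub>j\<^sub>'\<close>
  switches (\<open>path_weight_le_z\<close>). Finally \<open>z(\<rho>) \<le> z(\<tau>)\<close>, because the magazines of the deleted jobs can
  be skipped: \<open>|C - A| \<le> |B - A| + |C - B|\<close> (\<open>z_subseq\<close>).
\<close>

section \<open>Hamiltonian paths as spanning trees\<close>

definition path_edges :: "'a list \<Rightarrow> 'a set set" where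
  "path_edges p = (\<lambda>i. {p ! i, p ! Suc i}) ` {i. Suc i < length p}"

text \<open>The cycle is closed up by the edge from its last to its first vertex, so these two vertices
  need their own cases.\<close>

lemma graph_cycle_two_neighbours:
  assumes "graph_cycle E p" and "v \<in> set p"
  shows "\<exists>a\<in>set p. \<exists>b\<in>set p. a \<noteq> b \<and> {v, a} \<in> E \<and> {v, b} \<in> E"
proof -
  have len: "3 \<le> length p" and dist: "distinct p"
    and edge: "\<And>i. Suc i < length p \<Longrightarrow> {p ! i, p ! Suc i} \<in> E"
    using assms(1) by (auto simp: graph_cycle_def)
  have "p \<noteq> []" using len by auto
  then have closing: "{p ! (length p - 1), p ! 0} \<in> E"
    using assms(1) by (simp add: graph_cycle_def last_conv_nth hd_conv_nth)
  obtain i where i: "i < length p" "v = p ! i"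
    using assms(2) by (auto simp: in_set_conv_nth)
  have neighbours: ?thesis
    if "k < length p" "l < length p" "k \<noteq> l" "{p ! i, p ! k} \<in> E" "{p ! i, p ! l} \<in> E" for k l
    using that i dist by (metis nth_mem nth_eq_iff_index_eq)
  consider "i = 0" | "Suc i = length p" | k where "i = Suc k" "Suc i < length p"
    using i(1) by (cases i) force+
  then show ?thesis
  proof cases
    case 1
    then show ?thesis
      using neighbours[of 1 "length p - 1"] edge[of 0] closing len by (simp add: insert_commute)
  next
    case 2
    then show ?thesis
      using neighbours[of 0 "i - 1"] edge[of "i - 1"] closing len
      by (simp add: insert_commute flip: 2)
  next
    case 3
    then show ?thesis
      using neighbours[of k "Suc i"] edge[of k] edge[of i] by (simp add: insert_commute)
  qed
qed

text \<open>The vertex of a cycle that comes last on the path would have to have both of its neighbours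
  on the cycle immediately before it.\<close>

lemma path_edges_acyclic:
  assumes "distinct p"
  shows "\<not> graph_cycle (path_edges p) q"
proof
  assume cyc: "graph_cycle (path_edges p) q"
  define I where "I = {i. i < length p \<and> p ! i \<in> set q}"
  have vertex_on_path: "\<exists>i<length p. p ! i = v" if "{v, a} \<in> path_edges p" for v a
    using that unfolding path_edges_def by (fastforce simp: doubleton_eq_iff dest: Suc_lessD)
  have "q \<noteq> []" using cyc by (auto simp: graph_cycle_def)
  then obtain v where "v \<in> set q" by (meson hd_in_set)
  then have "I \<noteq> {}"
    using graph_cycle_two_neighbours[OF cyc] vertex_on_path unfolding I_def by blast
  moreover have fin: "finite I" by (simp add: I_def)
  ultimately have "Max I \<in> I" by simp
  then have top: "Max I < length p" "p ! Max I \<in> set q" by (auto simp: I_def)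
  have "a = p ! (Max I - 1)" if a: "a \<in> set q" "{p ! Max I, a} \<in> path_edges p" for a
  proof -
    obtain k where k: "Suc k < length p" "{p ! Max I, a} = {p ! k, p ! Suc k}"
      using a(2) by (auto simp: path_edges_def)
    then consider "p ! Max I = p ! k" "a = p ! Suc k" | "p ! Max I = p ! Suc k" "a = p ! k"
      by (auto simp: doubleton_eq_iff)
    then show ?thesis
    proof cases
      case 1
      then have "Max I = k" using assms top(1) k(1) by (simp add: nth_eq_iff_index_eq)
      moreover have "Suc k \<le> Max I" using 1 a(1) k(1) fin by (auto simp: I_def)
      ultimately show ?thesis by simp
    next
      case 2
      then have "Max I = Suc k" using assms top(1) k(1) by (simp add: nth_eq_iff_index_eq)
      with 2 show ?thesis by simp
    qed
  qed
  then show False using graph_cycle_two_neighbours[OF cyc top(2)] by metis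
qed

lemma path_edges_connected:
  assumes "p \<noteq> []"
  shows "graph_connected (set p) (path_edges p)"
proof -
  let ?R = "{(x, y). {x, y} \<in> path_edges p}"
  have from_start: "(p ! 0, p ! i) \<in> ?R\<^sup>*" if "i < length p" for i
    using that
  proof (induction i)
    case (Suc i)
    then have "(p ! i, p ! Suc i) \<in> ?R" by (auto simp: path_edges_def)
    with Suc show ?case by (simp add: rtrancl.rtrancl_into_rtrancl)
  qed simp
  have "sym ?R" by (auto simp: sym_def insert_commute)
  then have "sym (?R\<^sup>*)" by (rule sym_rtrancl)
  have "(u, v) \<in> ?R\<^sup>*" if uv: "u \<in> set p" "v \<in> set p" for u v
  proof -
    have "(p ! 0, u) \<in> ?R\<^sup>*" "(p ! 0, v) \<in> ?R\<^sup>*"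
      using uv from_start by (auto simp: in_set_conv_nth)
    with \<open>sym (?R\<^sup>*)\<close> show ?thesis by (blast dest: symD intro: rtrancl_trans)
  qed
  with assms show ?thesis by (auto simp: graph_connected_def)
qed

lemma spanning_tree_path_edges:
  assumes "distinct p" and "p \<noteq> []" and "path_edges p \<subseteq> E"
  shows "spanning_tree (set p) E (path_edges p)"
  using assms path_edges_acyclic path_edges_connected unfolding spanning_tree_def by blast


section \<open>Switches of subsequences\<close>

lemma card_Diff_triangle:
  assumes "finite B" and "finite C"
  shows "card (C - A) \<le> card (B - A) + card (C - B)"
proof -
  have "card (C - A) \<le> card ((B - A) \<union> (C - B))"
    using assms by (intro card_mono) auto
  also have "\<dots> \<le> card (B - A) + card (C - B)" by (rule card_Un_le)
  finally show ?thesis .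
qed

context ssp
begin

lemma switches_singleton: "switches [A] = 0"
  by (simp add: switches_def)

lemma switches_Cons_Cons: "switches (A # B # Ms) = card (B - A) + switches (B # Ms)"
proof -
  let ?f = "\<lambda>Ns i. card (Ns ! i - Ns ! (i - 1))"
  have "switches (A # B # Ms) = card (B - A) + (\<Sum>i = Suc 1..<Suc (length (B # Ms)). ?f (A # B # Ms) i)"
    by (simp add: switches_def sum.atLeast_Suc_lessThan)
  also have "(\<Sum>i = Suc 1..<Suc (length (B # Ms)). ?f (A # B # Ms) i) = switches (B # Ms)"
    unfolding switches_def sum.shift_bounds_Suc_ivl by (intro sum.cong) (auto simp: nth_Cons')
  finally show ?thesis .
qed

lemma switches_skip:
  assumes "finite B" and "\<forall>M\<in>set Ms. finite M"
  shows "switches (A # Ms) \<le> switches (A # B # Ms)"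
proof (cases Ms)
  case (Cons C Ns)
  then show ?thesis
    using assms card_Diff_triangle[of B C A] by (simp add: switches_Cons_Cons)
qed (simp add: switches_singleton)

text \<open>A common first magazine \<open>A\<close> makes the induction on the subsequence go through: it remains the
  reference point when the magazine behind it is skipped.\<close>

lemma switches_Cons_subseq:
  assumes "subseq Ns Ms" and "\<forall>M\<in>set Ms. finite M"
  shows "switches (A # Ns) \<le> switches (A # Ms)"
  using assms
proof (induction arbitrary: A rule: list_emb.induct)
  case (list_emb_Nil Ms)
  show ?case by (simp add: switches_singleton)
next
  case (list_emb_Cons Ns Ms B)
  then have "switches (A # Ns) \<le> switches (A # Ms)" by simp
  also have "\<dots> \<le> switches (A # B # Ms)"
    using list_emb_Cons.prems by (intro switches_skip) auto
  finally show ?case .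
next
  case (list_emb_Cons2 M N Ns Ms)
  then show ?case by (simp add: switches_Cons_Cons)
qed

lemma switches_subseq:
  assumes "subseq Ns Ms" and "\<forall>M\<in>set Ms. finite M"
  shows "switches Ns \<le> switches Ms"
proof (cases Ns)
  case (Cons N Ns')
  then obtain Ks Ls where Ms: "Ms = Ks @ N # Ls" and sub: "subseq Ns' Ls"
    using assms(1) by (auto simp: Cons dest!: list_emb_ConsD)
  have "switches (N # Ls) \<le> switches (Ks @ N # Ls)"
    using assms(2) unfolding Ms
  proof (induction Ks)
    case (Cons K Ks)
    have "switches (N # Ls) \<le> switches (Ks @ N # Ls)" using Cons by simp
    also have "\<dots> \<le> switches (K # Ks @ N # Ls)"
      by (cases Ks) (simp_all add: switches_Cons_Cons)
    finally show ?case by simp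
  qed simp
  moreover have "switches (N # Ns') \<le> switches (N # Ls)"
    using sub assms(2) by (intro switches_Cons_subseq) (auto simp: Ms)
  ultimately show ?thesis by (simp add: Cons Ms)
qed (simp add: switches_def)

lemma covers_Nil: "covers Ms [] \<longleftrightarrow> Ms = []"
  by (auto simp: covers_def)

lemma covers_Cons:
  "covers Ms (j # \<sigma>) \<longleftrightarrow>
     (\<exists>M Ms'. Ms = M # Ms' \<and> configuration M \<and> req j \<subseteq> M \<and> covers Ms' \<sigma>)"
  by (cases Ms) (auto simp: covers_def All_less_Suc2)

lemma covers_subseq:
  assumes "subseq \<rho> \<tau>" and "covers Ms \<tau>"
  shows "\<exists>Ns. subseq Ns Ms \<and> covers Ns \<rho>"
  using assms
proof (induction arbitrary: Ms rule: list_emb.induct)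
  case (list_emb_Nil \<tau>)
  show ?case by (intro exI[of _ "[]"]) (simp add: covers_Nil)
next
  case (list_emb_Cons \<rho> \<tau> j)
  from list_emb_Cons.prems obtain M Ms' where Ms: "Ms = M # Ms'" and "covers Ms' \<tau>"
    unfolding covers_Cons by blast
  with list_emb_Cons.IH obtain Ns where "subseq Ns Ms'" "covers Ns \<rho>" by blast
  then show ?case unfolding Ms by (intro exI[of _ Ns]) (simp add: list_emb.list_emb_Cons)
next
  case (list_emb_Cons2 j j' \<rho> \<tau>)
  from list_emb_Cons2.prems list_emb_Cons2.hyps obtain M Ms'
    where Ms: "Ms = M # Ms'" "configuration M" "req j \<subseteq> M" and "covers Ms' \<tau>"
    unfolding covers_Cons by blast
  with list_emb_Cons2.IH obtain Ns where "subseq Ns Ms'" "covers Ns \<rho>" by blast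
  with Ms show ?case by (intro exI[of _ "M # Ns"]) (simp add: covers_Cons)
qed

lemma z_attained:
  assumes "partial_seq \<sigma>"
  obtains Ms where "covers Ms \<sigma>" and "z \<sigma> = switches Ms"
proof -
  have "z \<sigma> \<in> {switches Ms | Ms. covers Ms \<sigma>}"
    unfolding z_def using ex_covers[OF assms] by (intro Min_in finite_switches) auto
  then show ?thesis using that by auto
qed

lemma configuration_finite: "configuration M \<Longrightarrow> finite M"
  by (auto simp: configuration_def intro: finite_subset)

lemma z_subseq:
  assumes "subseq \<rho> \<tau>" and "partial_seq \<tau>"
  shows "z \<rho> \<le> z \<tau>"
proof -
  obtain Ms where Ms: "covers Ms \<tau>" "z \<tau> = switches Ms"
    using z_attained[OF assms(2)] .
  obtain Ns where Ns: "subseq Ns Ms" "covers Ns \<rho>"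
    using covers_subseq[OF assms(1) Ms(1)] by blast
  have "z \<rho> \<le> switches Ns"
    unfolding z_def using Ns(2) by (intro Min_le finite_switches) auto
  also have "\<dots> \<le> switches Ms"
    using Ms(1) configuration_finite by (intro switches_subseq Ns(1)) (auto simp: covers_def)
  finally show ?thesis by (simp add: Ms(2))
qed


section \<open>The path of a completion\<close>

text \<open>The \<open>c\<close> tools already loaded for \<open>j\<close> can supply at most \<open>c\<close> of the tools in
  \<open>T\<^sub>j \<union> T\<^sub>j\<^sub>'\<close>.\<close>

lemma weight_le_card_Diff:
  assumes "configuration M" "configuration M'" and "req j \<subseteq> M" "req j' \<subseteq> M'"
  shows "weight {j, j'} \<le> card (M' - M)"
proof -
  have "card (req j \<union> req j') \<le> card (M \<union> (M' - M))"
    using assms by (intro card_mono) (auto simp: configuration_finite)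
  also have "\<dots> \<le> c + card (M' - M)"
    using card_Un_le[of M "M' - M"] assms(1) by (simp add: configuration_def)
  finally show ?thesis by (simp add: weight_def)
qed

lemma path_weight_le_z:
  assumes "partial_seq \<rho>"
  shows "(\<Sum>e\<in>path_edges \<rho>. weight e) \<le> z \<rho>"
proof -
  obtain Ms where Ms: "covers Ms \<rho>" "z \<rho> = switches Ms"
    using z_attained[OF assms] .
  let ?I = "{i. Suc i < length \<rho>}"
  have I: "?I = {0..<length \<rho> - 1}" by auto
  have "(\<Sum>e\<in>path_edges \<rho>. weight e) \<le> (\<Sum>i\<in>?I. weight {\<rho> ! i, \<rho> ! Suc i})"
    unfolding path_edges_def I using sum_image_le[of "{0..<length \<rho> - 1}" weight] by (simp add: comp_def)
  also have "\<dots> \<le> (\<Sum>i\<in>?I. card (Ms ! Suc i - Ms ! i))"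
    using Ms(1) by (intro sum_mono weight_le_card_Diff) (auto simp: covers_def)
  also have "\<dots> = (\<Sum>i = Suc 0..<Suc (length \<rho> - 1). card (Ms ! i - Ms ! (i - 1)))"
    unfolding I sum.shift_bounds_Suc_ivl by simp
  also have "\<dots> = switches Ms"
    using Ms(1) by (cases "length \<rho>") (simp_all add: switches_def covers_def)
  finally show ?thesis by (simp add: Ms(2))
qed

text \<open>Filtering deletes nothing between two kept neighbours.\<close>

lemma consecutive_filter:
  assumes "Suc i < length \<rho>" and "P (\<rho> ! i)" "P (\<rho> ! Suc i)"
  shows "consecutive (filter P \<rho>) (\<rho> ! i) (\<rho> ! Suc i)"
proof -
  let ?k = "length (filter P (take i \<rho>))"
  have "\<rho> = take i \<rho> @ \<rho> ! i # \<rho> ! Suc i # drop (Suc (Suc i)) \<rho>"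
    using assms(1) by (metis Cons_nth_drop_Suc Suc_lessD append_take_drop_id)
  then have "filter P \<rho> = filter P (take i \<rho>) @ \<rho> ! i # \<rho> ! Suc i # filter P (drop (Suc (Suc i)) \<rho>)"
    using assms(2,3) by (metis filter.simps(2) filter_append)
  then show ?thesis unfolding consecutive_def by (intro exI[of _ ?k]) (simp add: nth_append)
qed

lemma L3_le_weight:
  assumes "finite (G_verts \<sigma> \<Omega>)" and "spanning_tree (G_verts \<sigma> \<Omega>) (G_edges \<sigma> \<Omega>) F"
  shows "L3 \<sigma> \<Omega> \<le> (\<Sum>e\<in>F. weight e)"
proof -
  have "{F. spanning_tree (G_verts \<sigma> \<Omega>) (G_edges \<sigma> \<Omega>) F} \<subseteq> Pow (Pow (G_verts \<sigma> \<Omega>))"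
    by (auto simp: spanning_tree_def G_edges_def)
  then have "finite {F. spanning_tree (G_verts \<sigma> \<Omega>) (G_edges \<sigma> \<Omega>) F}"
    using assms(1) by (meson finite_Pow_iff finite_subset)
  then show ?thesis unfolding L3_def using assms(2) by (intro Min_le) auto
qed

end

context pibb
begin

lemma path_edges_subset_G:
  assumes "distinct \<rho>" and "set \<rho> = G_verts \<sigma> \<Omega>" and "subseq \<sigma> \<rho>"
  shows "path_edges \<rho> \<subseteq> G_edges \<sigma> \<Omega>"
proof
  fix e
  assume "e \<in> path_edges \<rho>"
  then obtain i where i: "Suc i < length \<rho>" and e: "e = {\<rho> ! i, \<rho> ! Suc i}"
    by (auto simp: path_edges_def)
  have "\<rho> ! i \<noteq> \<rho> ! Suc i" using i assms(1) by (simp add: nth_eq_iff_index_eq)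
  moreover have "\<rho> ! i \<in> G_verts \<sigma> \<Omega>" "\<rho> ! Suc i \<in> G_verts \<sigma> \<Omega>"
    using i assms(2) nth_mem[of _ \<rho>] by auto
  moreover have "consecutive \<sigma> j j'" if "e = {j, j'}" "j \<in> set \<sigma>" "j' \<in> set \<sigma>" for j j'
  proof -
    have "\<rho> ! i \<in> set \<sigma>" "\<rho> ! Suc i \<in> set \<sigma>" using that by (auto simp: e doubleton_eq_iff)
    then have "consecutive (filter (\<lambda>x. x \<in> set \<sigma>) \<rho>) (\<rho> ! i) (\<rho> ! Suc i)"
      using i by (intro consecutive_filter)
    moreover have "filter (\<lambda>x. x \<in> set \<sigma>) \<rho> = \<sigma>"
      using assms(3,1) by (rule subseq_distinct_filter)
    ultimately show ?thesis using that(1) unfolding consecutive_def e by simp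
  qed
  ultimately show "e \<in> G_edges \<sigma> \<Omega>" unfolding G_edges_def e by blast
qed

lemma L3_le_z_completion:
  assumes "node \<sigma>" and "\<Omega> \<subseteq> rest \<sigma>" and "completion \<sigma> \<tau>"
  shows "L3 \<sigma> \<Omega> \<le> z \<tau>"
proof -
  define \<rho> where "\<rho> = filter (\<lambda>j. j \<in> G_verts \<sigma> \<Omega>) \<tau>"
  have \<tau>: "distinct \<tau>" "set \<tau> = {1..n}" "subseq \<sigma> \<tau>"
    using assms(1,3) completion_iff by auto
  have \<sigma>: "partial_seq \<sigma>" "\<sigma> \<noteq> []" using node_partial_seq[OF assms(1)] by auto
  have verts: "G_verts \<sigma> \<Omega> \<subseteq> {1..n}"
    using \<sigma>(1) assms(2) by (auto simp: G_verts_def partial_seq_def rest_def)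
  then have set\<rho>: "set \<rho> = G_verts \<sigma> \<Omega>" using \<tau>(2) by (auto simp: \<rho>_def)
  have \<rho>: "distinct \<rho>" "partial_seq \<rho>"
    using \<tau>(1) set\<rho> verts by (auto simp: \<rho>_def partial_seq_def)
  have "\<rho> \<noteq> []" using set\<rho> \<sigma>(2) by (auto simp: G_verts_def)
  have "filter (\<lambda>j. j \<in> G_verts \<sigma> \<Omega>) \<sigma> = \<sigma>"
    by (auto simp: G_verts_def filter_id_conv)
  with \<tau>(3) have "subseq \<sigma> \<rho>" unfolding \<rho>_def by (metis subseq_filter)
  then have "spanning_tree (G_verts \<sigma> \<Omega>) (G_edges \<sigma> \<Omega>) (path_edges \<rho>)"
    using spanning_tree_path_edges[OF \<rho>(1) \<open>\<rho> \<noteq> []\<close>] path_edges_subset_G[OF \<rho>(1) set\<rho>] set\<rho> by metis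
  then have "L3 \<sigma> \<Omega> \<le> (\<Sum>e\<in>path_edges \<rho>. weight e)"
    using verts by (intro L3_le_weight) (auto intro: finite_subset)
  also have "\<dots> \<le> z \<rho>" using \<rho>(2) by (rule path_weight_le_z)
  also have "\<dots> \<le> z \<tau>"
    using \<tau> by (intro z_subseq) (auto simp: \<rho>_def partial_seq_def)
  finally show ?thesis .
qed

text \<open>Appending the missing jobs to a node in any order completes it, so the minimum that defines the
  optimal value ranges over a nonempty set.\<close>

lemma opt_attained:
  assumes "node \<sigma>"
  shows "\<exists>\<tau>. completion \<sigma> \<tau> \<and> opt \<sigma> = z \<tau>"
proof -
  have "completion \<sigma> (\<sigma> @ sorted_list_of_set (rest \<sigma>))"
    unfolding completion_iff[OF assms]
    using node_partial_seq[OF assms] by (auto simp: partial_seq_def rest_def)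
  moreover have "{\<tau>. completion \<sigma> \<tau>} \<subseteq> {\<tau>. set \<tau> \<subseteq> {1..n} \<and> length \<tau> = n}"
    using completion_iff[OF assms] by (auto simp: completion_def)
  then have "finite {\<tau>. completion \<sigma> \<tau>}"
    by (rule finite_subset) (simp add: finite_lists_length_eq)
  ultimately have "opt \<sigma> \<in> {z \<tau> | \<tau>. completion \<sigma> \<tau>}"
    unfolding opt_def by (intro Min_in) auto
  then show ?thesis by auto
qed

end

theorem proposition3:
  fixes m n c :: nat and req :: "nat \<Rightarrow> nat set"
    and root :: "nat \<times> nat" and sel :: "nat list \<Rightarrow> nat"
    and \<sigma> :: "nat list" and \<Omega> :: "nat set"
  assumes "pibb m n c req root sel"
    and "pibb.node n root sel \<sigma>"
    and "\<Omega> \<subseteq> ssp.rest n \<sigma>"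
  shows "ssp.L3 c req \<sigma> \<Omega> \<le> pibb.opt m n c req sel \<sigma> \<and>
    (\<forall>\<tau>. pibb.completion n sel \<sigma> \<tau> \<longrightarrow> ssp.L3 c req \<sigma> \<Omega> \<le> ssp.z m c req \<tau>)"
proof -
  interpret pibb m n c req root sel by (rule assms(1))
  show ?thesis
    using L3_le_z_completion[OF assms(2,3)] opt_attained[OF assms(2)] by metis
qed

end
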